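(* Let $1\le q<\infty$, let $A$ be a nonzero real $N\times n$ matrix with rows $v_1,\dots,v_N\in\mathbb{R}^n$, let $0<\varepsilon\le(\operatorname{rk}(A))^{-1/q}$, and let $X$ be an $n$-dimensional normed space, namely $\mathbb{R}^n$ equipped with a norm $\|\cdot\|_X$. Assume that $$|(v_{i_0},x)|\le\varepsilon\Bigl(\sum_{i=1}^N|(v_i,x)|^q\Bigr)^{1/q}\quad\text{for all } x\in\mathbb{R}^n \text{ and all } i_0\in\{1,\dots,N\}.$$ Then there exists a partition $\{1,\dots,N\}=\Omega_1\cup\Omega_2$, $\Omega_1\cap\Omega_2=\emptyset$, such that for $k=1,2$ $$\|A(\Omega_k)\|_{(X,q)}\le\gamma\,\|A\|_{(X,q)},$$ where $$\gamma=\frac{1}{2^{1/q}}+\frac{2+3\cdot 2^{-1/q}}{q}\left(\operatorname{rk}(A)\,\varepsilon^q\,\ln\frac{6q}{(\operatorname{rk}(A)\,\varepsilon^q)^{1/3}}\right)^{1/3}.$$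
   Context: $\operatorname{rk}(A)$ is the rank of $A$; $(\cdot,\cdot)$ is the standard inner product on $\mathbb{R}^n$; $\|\cdot\|_q$ is the $\ell_q$-norm. For $\omega\subset\{1,\dots,N\}$, $A(\omega)$ is the submatrix of $A$ formed by the rows $v_i$, $i\in\omega$. For a matrix $B$ with $n$ columns, the $(X,q)$-norm is $\|B\|_{(X,q)}=\sup_{\|x\|_X\le1}\|Bx\|_q$ (equal to $0$ for a submatrix with no rows). The parts of a partition are only required to be disjoint with union $\{1,\dots,N\}$. *)

theory Defs
  imports "HOL-Analysis.Analysis"
begin

definition is_norm :: "('a::real_vector \<Rightarrow> real) \<Rightarrow> bool" where
  "is_norm nX \<longleftrightarrow>
     (\<forall>x. 0 \<le> nX x) \<and>
     (\<forall>x. nX x = 0 \<longleftrightarrow> x = 0) \<and>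
     (\<forall>c x. nX (c *\<^sub>R x) = \<bar>c\<bar> * nX x) \<and>
     (\<forall>x y. nX (x + y) \<le> nX x + nX y)"

definition lq_norm :: "real \<Rightarrow> 'i set \<Rightarrow> ('i \<Rightarrow> real) \<Rightarrow> real" where
  "lq_norm q I y = (\<Sum>i\<in>I. \<bar>y i\<bar> powr q) powr (1 / q)"

(* The submatrix A(I) is represented by its row index set I together with the rows of A:
   the coordinates of A(I) x are the numbers (A *v x) $ i for i in I.  In particular
   the matrix itself is the case I = UNIV, and I = {} gives the value 0.
   The supremum is over a nonempty set, which is bounded above when nX is a norm and q > 0. *)
definition Xq_norm ::
    "(real^'n \<Rightarrow> real) \<Rightarrow> real \<Rightarrow> real^'n^'m \<Rightarrow> 'm set \<Rightarrow> real" where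
  "Xq_norm nX q A I = (SUP x\<in>{x. nX x \<le> 1}. lq_norm q I (\<lambda>i. (A *v x) $ i))"

definition splitting_const :: "real \<Rightarrow> nat \<Rightarrow> real \<Rightarrow> real" where
  "splitting_const q r \<epsilon> =
     1 / 2 powr (1 / q) +
     (2 + 3 * 2 powr (- 1 / q)) / q *
       (real r * \<epsilon> powr q * ln (6 * q / (real r * \<epsilon> powr q) powr (1 / 3))) powr (1 / 3)"

end

theory Submission
  imports Defs
begin

text \<open>A uniformly random subset \<open>\<Omega>\<close> of the rows splits the sum of the \<open>\<bar>y i\<bar> powr q\<close> of a
  single vector \<open>y\<close> of \<open>range A\<close> with \<open>lq_norm q UNIV y = 1\<close> nearly in half, with sub-Gaussian deviations of
  variance at most \<open>\<epsilon> powr q\<close>, because all coordinates of \<open>y\<close> are at most \<open>\<epsilon>\<close>. The unit sphere of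
  \<open>range A\<close> has an \<open>\<eta>\<close>-net of at most \<open>(1 + 2 / \<eta>) ^ rank A\<close> points, so one \<open>\<Omega>\<close> works for the
  whole net, and the triangle inequality adds \<open>\<eta>\<close> for all other vectors. With
  \<open>t = rank A * \<epsilon> powr q\<close>, \<open>L = ln (6 * q / t powr (1/3))\<close> and \<open>w = (t * L) powr (1/3)\<close>, the
  choice is \<open>\<eta> = 2 * w / q\<close> with deviation \<open>3 * w\<close>. This needs \<open>t * L \<le> w\<^sup>2\<close>, that is
  \<open>t * L \<le> 1\<close>; otherwise \<open>\<gamma> \<ge> 1\<close> and the trivial partition does.\<close>

section \<open>Norms on Euclidean spaces and their comparison with the Euclidean norm\<close>

lemma is_normD:
  assumes "is_norm N"
  shows is_norm_nonneg: "0 \<le> N x"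
    and is_norm_eq_0_iff: "N x = 0 \<longleftrightarrow> x = 0"
    and is_norm_scaleR: "N (c *\<^sub>R x) = \<bar>c\<bar> * N x"
    and is_norm_triangle: "N (x + y) \<le> N x + N y"
  using assms by (auto simp: is_norm_def)

lemma is_norm_zero: "is_norm N \<Longrightarrow> N 0 = 0"
  by (simp add: is_norm_eq_0_iff)

lemma is_norm_minus: "is_norm N \<Longrightarrow> N (- x) = N x"
  using is_norm_scaleR[of N "-1" x] by simp

lemma is_norm_triangle_diff:
  assumes "is_norm N"
  shows "N (x - y) \<le> N x + N y"
  using is_norm_triangle[OF assms, of x "- y"] by (simp add: is_norm_minus[OF assms])

lemma is_norm_sum:
  assumes "is_norm N"
  shows "N (\<Sum>i\<in>I. f i) \<le> (\<Sum>i\<in>I. N (f i))"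
proof (induction I rule: infinite_finite_induct)
  case (insert i I)
  then show ?case
    using is_norm_triangle[OF assms, of "f i" "\<Sum>i\<in>I. f i"] by simp
qed (simp_all add: is_norm_zero[OF assms])

lemma is_norm_le_norm:
  fixes N :: "'a::euclidean_space \<Rightarrow> real"
  assumes "is_norm N"
  obtains C where "0 \<le> C" "\<And>x. N x \<le> C * norm x"
proof
  show "0 \<le> (\<Sum>b\<in>Basis. N b)"
    by (simp add: is_norm_nonneg[OF assms] sum_nonneg)
  fix x :: 'a
  have "N x = N (\<Sum>b\<in>Basis. (x \<bullet> b) *\<^sub>R b)"
    by (simp add: euclidean_representation)
  also have "\<dots> \<le> (\<Sum>b\<in>Basis. N ((x \<bullet> b) *\<^sub>R b))"
    by (rule is_norm_sum[OF assms])
  also have "\<dots> \<le> (\<Sum>b\<in>Basis. norm x * N b)"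
    unfolding is_norm_scaleR[OF assms]
    by (intro sum_mono mult_right_mono Basis_le_norm is_norm_nonneg[OF assms])
  finally show "N x \<le> (\<Sum>b\<in>Basis. N b) * norm x"
    by (simp add: sum_distrib_left mult.commute)
qed

text \<open>The triangle inequality and \<open>is_norm_le_norm\<close> make \<open>N\<close>
  Lipschitz.\<close>

lemma is_norm_continuous_on:
  fixes N :: "'a::euclidean_space \<Rightarrow> real"
  assumes "is_norm N"
  shows "continuous_on S N"
proof -
  obtain C where C: "0 \<le> C" "\<And>x. N x \<le> C * norm x"
    using is_norm_le_norm[OF assms] by blast
  have "\<bar>N x - N y\<bar> \<le> C * norm (x - y)" for x y
    using is_norm_triangle[OF assms, of "x - y" y] is_norm_triangle[OF assms, of "y - x" x]
      C(2)[of "x - y"] C(2)[of "y - x"] by (simp add: norm_minus_commute)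
  then have "C-lipschitz_on S N"
    using C(1) by (auto intro!: lipschitz_onI simp: dist_norm)
  then show ?thesis
    by (rule lipschitz_on_continuous_on)
qed

text \<open>By compactness \<open>N\<close> attains its minimum on the Euclidean unit sphere. The
  minimum is positive because \<open>N\<close> vanishes only at 0, and homogeneity carries the bound
  to all vectors.\<close>

lemma is_norm_ge_norm:
  fixes N :: "'a::euclidean_space \<Rightarrow> real"
  assumes "is_norm N"
  obtains c where "0 < c" "\<And>x. c * norm x \<le> N x"
proof -
  have "\<exists>x\<in>sphere (0::'a) 1. \<forall>y\<in>sphere 0 1. N x \<le> N y"
    by (intro continuous_attains_inf is_norm_continuous_on[OF assms]) simp_all
  then obtain x0 :: 'a where x0: "norm x0 = 1" "\<And>y. norm y = 1 \<Longrightarrow> N x0 \<le> N y"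
    by auto
  show thesis
  proof
    show "0 < N x0"
      using x0(1) is_norm_nonneg[OF assms, of x0] is_norm_eq_0_iff[OF assms, of x0]
      by (metis norm_zero order_le_less zero_neq_one)
    fix x :: 'a
    show "N x0 * norm x \<le> N x"
    proof (cases "x = 0")
      case False
      then have "N x0 \<le> N (inverse (norm x) *\<^sub>R x)"
        by (intro x0(2)) simp
      with False show ?thesis
        by (simp add: is_norm_scaleR[OF assms] field_simps)
    qed (simp add: is_norm_nonneg[OF assms])
  qed
qed

section \<open>The lq norm and Minkowski's inequality\<close>

text \<open>Covers the boundary as well: when one of the points is 0, convexity reduces to
  \<open>w powr p \<le> w\<close> for a weight \<open>w\<close> in [0,1].\<close>

lemma convex_on_powr_nonneg:
  fixes p a b u v :: real
  assumes "1 \<le> p" "0 \<le> a" "0 \<le> b" "0 \<le> u" "0 \<le> v" "u + v = 1"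
  shows "(u * a + v * b) powr p \<le> u * a powr p + v * b powr p"
proof -
  have le: "w powr p \<le> w" if "0 \<le> w" "w \<le> 1" for w :: real
    using that assms(1) powr_mono'[of 1 p w] by (cases "w = 0") auto
  consider "a = 0" | "b = 0" | "0 < a" "0 < b"
    using assms by fastforce
  then show ?thesis
  proof cases
    case 1
    then show ?thesis
      using assms le[of v] by (simp add: powr_mult mult_right_mono)
  next
    case 2
    then show ?thesis
      using assms le[of u] by (simp add: powr_mult mult_right_mono)
  next
    case 3
    then show ?thesis
      using powr_convex[OF assms(1)] assms(4-6) by (auto simp: convex_on_def)
  qed
qed

lemma lq_norm_nonneg: "0 \<le> lq_norm q I y"
  by (simp add: lq_norm_def)

lemma lq_norm_empty: "lq_norm q {} y = 0"
  by (simp add: lq_norm_def)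

lemma lq_norm_powr:
  assumes "0 < q"
  shows "lq_norm q I y powr q = (\<Sum>i\<in>I. \<bar>y i\<bar> powr q)"
  using assms by (simp add: lq_norm_def powr_powr sum_nonneg)

lemma lq_norm_scale:
  assumes "0 < q"
  shows "lq_norm q I (\<lambda>i. c * y i) = \<bar>c\<bar> * lq_norm q I y"
  using assms
  by (simp add: lq_norm_def abs_mult powr_mult powr_powr sum_nonneg flip: sum_distrib_left)

lemma lq_norm_mono:
  assumes "0 < q" "finite J" "I \<subseteq> J"
  shows "lq_norm q I y \<le> lq_norm q J y"
  using assms by (auto simp: lq_norm_def intro!: powr_mono2 sum_mono2 sum_nonneg)

lemma lq_norm_eq_0_iff:
  assumes "0 < q" "finite I"
  shows "lq_norm q I y = 0 \<longleftrightarrow> (\<forall>i\<in>I. y i = 0)"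
  using assms by (simp add: lq_norm_def sum_nonneg_eq_0_iff)

text \<open>Minkowski's inequality. With \<open>a\<close> and \<open>b\<close> the norms of
  \<open>x\<close> and \<open>y\<close>, each \<open>\<bar>x i + y i\<bar> / (a + b)\<close> is at
  most the convex combination of \<open>\<bar>x i\<bar> / a\<close> and
  \<open>\<bar>y i\<bar> / b\<close> with weights proportional to \<open>a\<close> and
  \<open>b\<close>. Convexity of \<open>powr q\<close> is applied in each coordinate and
  summed.\<close>

lemma lq_norm_triangle:
  assumes "1 \<le> q" "finite I"
  shows "lq_norm q I (\<lambda>i. x i + y i) \<le> lq_norm q I x + lq_norm q I y"
proof -
  define a b where "a = lq_norm q I x" and "b = lq_norm q I y"
  have ab: "0 \<le> a" "0 \<le> b"
    by (simp_all add: a_def b_def lq_norm_nonneg)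
  consider "a = 0" | "b = 0" | "0 < a" "0 < b"
    using ab by fastforce
  then show ?thesis
  proof cases
    case 1
    then have "\<forall>i\<in>I. x i = 0"
      using assms lq_norm_eq_0_iff[of q I x] by (simp add: a_def)
    then have "lq_norm q I (\<lambda>i. x i + y i) = lq_norm q I y"
      by (simp add: lq_norm_def)
    then show ?thesis
      by (simp add: lq_norm_nonneg)
  next
    case 2
    then have "\<forall>i\<in>I. y i = 0"
      using assms lq_norm_eq_0_iff[of q I y] by (simp add: b_def)
    then have "lq_norm q I (\<lambda>i. x i + y i) = lq_norm q I x"
      by (simp add: lq_norm_def)
    then show ?thesis
      by (simp add: lq_norm_nonneg)
  next
    case 3
    define u v where "u = a / (a + b)" and "v = b / (a + b)"
    have uv: "0 \<le> u" "0 \<le> v" "u + v = 1"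
      using 3 by (simp_all add: u_def v_def flip: add_divide_distrib)
    have pw: "\<bar>x i + y i\<bar> powr q \<le>
        (a + b) powr q * (u * (\<bar>x i\<bar> powr q / a powr q) + v * (\<bar>y i\<bar> powr q / b powr q))" for i
    proof -
      have "\<bar>x i + y i\<bar> \<le> (a + b) * (u * (\<bar>x i\<bar> / a) + v * (\<bar>y i\<bar> / b))"
        using 3 abs_triangle_ineq[of "x i" "y i"] by (simp add: u_def v_def distrib_left)
      then have "\<bar>x i + y i\<bar> powr q \<le> ((a + b) * (u * (\<bar>x i\<bar> / a) + v * (\<bar>y i\<bar> / b))) powr q"
        using assms by (intro powr_mono2) auto
      also have "\<dots> = (a + b) powr q * (u * (\<bar>x i\<bar> / a) + v * (\<bar>y i\<bar> / b)) powr q"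
        using 3 uv by (simp add: powr_mult)
      also have "\<dots> \<le> (a + b) powr q * (u * (\<bar>x i\<bar> / a) powr q + v * (\<bar>y i\<bar> / b) powr q)"
        using 3 uv assms by (intro mult_left_mono convex_on_powr_nonneg) auto
      finally show ?thesis
        using 3 by (simp add: powr_divide)
    qed
    have "lq_norm q I (\<lambda>i. x i + y i) powr q
        \<le> (\<Sum>i\<in>I. (a + b) powr q *
            (u * (\<bar>x i\<bar> powr q / a powr q) + v * (\<bar>y i\<bar> powr q / b powr q)))"
      unfolding lq_norm_powr[OF order.strict_trans2[OF zero_less_one assms(1)]]
      by (intro sum_mono pw)
    also have "\<dots> = (a + b) powr q * (u * ((\<Sum>i\<in>I. \<bar>x i\<bar> powr q) / a powr q)
        + v * ((\<Sum>i\<in>I. \<bar>y i\<bar> powr q) / b powr q))"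
      by (simp only: sum.distrib sum_divide_distrib flip: sum_distrib_left)
    also have "\<dots> = (a + b) powr q"
    proof -
      have "(\<Sum>i\<in>I. \<bar>x i\<bar> powr q) = a powr q" "(\<Sum>i\<in>I. \<bar>y i\<bar> powr q) = b powr q"
        using assms by (simp_all add: a_def b_def lq_norm_powr)
      then show ?thesis
        using 3 uv by simp
    qed
    finally have "lq_norm q I (\<lambda>i. x i + y i) powr q \<le> (a + b) powr q" .
    then show ?thesis
      using assms ab powr_less_mono2[of q "a + b" "lq_norm q I (\<lambda>i. x i + y i)"]
      unfolding a_def[symmetric] b_def[symmetric] by fastforce
  qed
qed

lemma is_norm_lq_norm:
  assumes "1 \<le> q"
  shows "is_norm (\<lambda>y::real^'m. lq_norm q UNIV (\<lambda>i. y $ i))"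
  unfolding is_norm_def
proof (intro conjI allI)
  fix c :: real and x y :: "real^'m"
  show "lq_norm q UNIV (\<lambda>i. (c *\<^sub>R x) $ i) = \<bar>c\<bar> * lq_norm q UNIV (\<lambda>i. x $ i)"
    using assms lq_norm_scale[of q UNIV c "\<lambda>i. x $ i"] by simp
  show "lq_norm q UNIV (\<lambda>i. (x + y) $ i) \<le> lq_norm q UNIV (\<lambda>i. x $ i) + lq_norm q UNIV (\<lambda>i. y $ i)"
    using assms lq_norm_triangle[of q UNIV "\<lambda>i. x $ i" "\<lambda>i. y $ i"] by simp
qed (use assms in \<open>simp_all add: lq_norm_nonneg lq_norm_eq_0_iff vec_eq_iff\<close>)

section \<open>Volume, packing and nets for the unit sphere of a subspace\<close>

text \<open>The subspace has smaller dimension than the ambient space, so its unit ball is thickened by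
  a unit cube in the complementary coordinates; the volume still scales like the power \<open>card J\<close>.\<close>
definition cyl_body :: "('a::euclidean_space \<Rightarrow> real) \<Rightarrow> 'a set \<Rightarrow> real \<Rightarrow> 'a set" where
  "cyl_body M J c = {x. M (\<Sum>j\<in>J. (x \<bullet> j) *\<^sub>R j) < c \<and> (\<forall>j\<in>Basis - J. \<bar>x \<bullet> j\<bar> < 1)}"

lemma inner_sum_Basis_subset:
  fixes J :: "'a::euclidean_space set"
  assumes "J \<subseteq> Basis" "i \<in> Basis"
  shows "(\<Sum>j\<in>J. g j *\<^sub>R j) \<bullet> i = (if i \<in> J then g i else 0)"
proof -
  have "finite J"
    using assms(1) finite_Basis finite_subset by blast
  have "(\<Sum>j\<in>J. g j *\<^sub>R j) \<bullet> i = (\<Sum>j\<in>J. if j = i then g i else 0)"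
    unfolding inner_sum_left using assms by (intro sum.cong) (auto simp: inner_Basis)
  also have "\<dots> = (if i \<in> J then g i else 0)"
    using \<open>finite J\<close> by (simp add: sum.delta)
  finally show ?thesis .
qed

lemma open_cyl_body:
  assumes "continuous_on UNIV M"
  shows "open (cyl_body M J c)"
proof -
  have "open {x. M (\<Sum>j\<in>J. (x \<bullet> j) *\<^sub>R j) < c}"
    by (intro open_Collect_less continuous_intros continuous_on_compose2[OF assms]) auto
  moreover have "open (\<Inter>j\<in>Basis - J. {x::'a. \<bar>x \<bullet> j\<bar> < 1})"
    by (intro open_INT open_Collect_less continuous_intros ballI) auto
  moreover have "cyl_body M J c = {x. M (\<Sum>j\<in>J. (x \<bullet> j) *\<^sub>R j) < c} \<inter> (\<Inter>j\<in>Basis - J. {x. \<bar>x \<bullet> j\<bar> < 1})"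
    by (auto simp: cyl_body_def)
  ultimately show ?thesis
    by auto
qed

text \<open>Coordinates in \<open>J\<close> are controlled by the lower bound for \<open>M\<close>
  on \<open>span J\<close>, the others by the cube. Boundedness makes the volume finite.\<close>

lemma bounded_cyl_body:
  fixes J :: "'a::euclidean_space set"
  assumes J: "J \<subseteq> Basis" and a: "0 < a" and M: "\<And>x. x \<in> span J \<Longrightarrow> a * norm x \<le> M x"
  shows "bounded (cyl_body M J c)"
proof (rule boundedI)
  fix x assume x: "x \<in> cyl_body M J c"
  have "\<bar>x \<bullet> i\<bar> \<le> \<bar>c\<bar> / a + 1" if i: "i \<in> Basis" for i
  proof (cases "i \<in> J")
    case True
    define p where "p = (\<Sum>j\<in>J. (x \<bullet> j) *\<^sub>R j)"
    have "p \<in> span J"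
      unfolding p_def by (intro span_sum span_scale span_base)
    then have "a * norm p \<le> \<bar>c\<bar>"
      using M[of p] x unfolding cyl_body_def p_def by simp linarith
    moreover have "\<bar>x \<bullet> i\<bar> \<le> norm p"
      using Basis_le_norm[OF i, of p] inner_sum_Basis_subset[OF J i] True by (simp add: p_def)
    ultimately have "a * \<bar>x \<bullet> i\<bar> \<le> \<bar>c\<bar>"
      using a by (meson mult_left_mono less_imp_le order_trans)
    then have "\<bar>x \<bullet> i\<bar> \<le> \<bar>c\<bar> / a"
      using a by (simp add: field_simps)
    then show ?thesis
      by simp
  next
    case False
    then have "\<bar>x \<bullet> i\<bar> < 1"
      using x i by (simp add: cyl_body_def)
    moreover have "0 \<le> \<bar>c\<bar> / a"
      using a by simp
    ultimately show ?thesis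
      by linarith
  qed
  then have "(\<Sum>i\<in>Basis. \<bar>x \<bullet> i\<bar>) \<le> (\<Sum>i\<in>(Basis::'a set). \<bar>c\<bar> / a + 1)"
    by (intro sum_mono)
  then show "norm x \<le> (\<Sum>i\<in>(Basis::'a set). \<bar>c\<bar> / a + 1)"
    using norm_le_l1[of x] by linarith
qed

text \<open>The diagonal map that scales the coordinates in \<open>J\<close> by \<open>c\<close> and
  fixes the others carries the body of radius 1 to that of radius \<open>c\<close>; its determinant
  is \<open>c ^ card J\<close>.\<close>

lemma emeasure_cyl_body:
  fixes J :: "'a::euclidean_space set"
  assumes J: "J \<subseteq> Basis" and cont: "continuous_on UNIV M" and c: "0 < c"
    and M: "\<And>x. M (c *\<^sub>R x) = c * M x"
  shows "emeasure lborel (cyl_body M J c) = ennreal (c ^ card J) * emeasure lborel (cyl_body M J 1)"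
proof -
  define d :: "'a \<Rightarrow> real" where "d j = (if j \<in> J then c else 1)" for j
  \<comment> \<open>The \<open>0 +\<close> is the zero translation in the affine form that
    \<open>lborel_affine_euclidean\<close> expects.\<close>
  define T where "T x = 0 + (\<Sum>j\<in>Basis. (d j * (x \<bullet> j)) *\<^sub>R j)" for x :: 'a
  have d: "d j \<noteq> 0" for j
    using c by (simp add: d_def)
  have T_inner: "T x \<bullet> j = d j * (x \<bullet> j)" if "j \<in> Basis" for x j
    using that by (simp add: T_def)
  have [measurable]: "T \<in> borel \<rightarrow>\<^sub>M borel"
    by (simp add: T_def[abs_def])
  have meas: "cyl_body M J c \<in> sets borel"
    using open_cyl_body[OF cont] by (rule borel_open)
  have "T x \<in> cyl_body M J c \<longleftrightarrow> x \<in> cyl_body M J 1" for x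
  proof -
    have "(\<Sum>j\<in>J. (T x \<bullet> j) *\<^sub>R j) = c *\<^sub>R (\<Sum>j\<in>J. (x \<bullet> j) *\<^sub>R j)"
      unfolding scaleR_sum_right using J by (intro sum.cong) (auto simp: T_inner d_def)
    moreover have "T x \<bullet> j = x \<bullet> j" if "j \<in> Basis - J" for j
      using that by (simp add: T_inner d_def)
    ultimately show ?thesis
      using c by (simp add: cyl_body_def M)
  qed
  then have vim: "T -` cyl_body M J c = cyl_body M J 1"
    by auto
  have prod: "(\<Prod>j\<in>Basis. \<bar>d j\<bar>) = c ^ card J"
  proof -
    have "(\<Prod>j\<in>Basis. \<bar>d j\<bar>) = (\<Prod>j\<in>J. c)"
      using J c by (intro prod.mono_neutral_cong_right) (auto simp: d_def)
    then show ?thesis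
      by simp
  qed
  have "lborel = density (distr lborel borel T) (\<lambda>_. (\<Prod>j\<in>Basis. \<bar>d j\<bar>))"
    unfolding T_def[abs_def] by (rule lborel_affine_euclidean) (rule d)
  then have "emeasure lborel (cyl_body M J c)
      = emeasure (density (distr lborel borel T) (\<lambda>_. ennreal (c ^ card J))) (cyl_body M J c)"
    unfolding prod by simp
  also have "\<dots> = ennreal (c ^ card J) * emeasure (distr lborel borel T) (cyl_body M J c)"
    using meas by (subst emeasure_density_const) simp_all
  also have "emeasure (distr lborel borel T) (cyl_body M J c) = emeasure lborel (cyl_body M J 1)"
    using meas by (subst emeasure_distr) (simp_all add: vim)
  finally show ?thesis .
qed

text \<open>Volume comparison: inside \<open>S\<close>, the open balls of radius
  \<open>\<eta> / 2\<close> about the points of \<open>T\<close> are disjoint and lie in the ball of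
  radius \<open>1 + \<eta> / 2\<close>. A linear isometry identifies \<open>S\<close> with a
  coordinate subspace \<open>span J\<close>, where \<open>cyl_body\<close> replaces these balls by
  sets of positive Lebesgue measure in the ambient space.\<close>

lemma packing_bound:
  fixes S :: "'a::euclidean_space set"
  assumes N: "is_norm N" and S: "subspace S" and \<eta>: "0 < \<eta>"
    and T: "finite T" "T \<subseteq> S" "\<And>z. z \<in> T \<Longrightarrow> N z \<le> 1"
    and sep: "\<And>z w. \<lbrakk>z \<in> T; w \<in> T; z \<noteq> w\<rbrakk> \<Longrightarrow> \<eta> \<le> N (z - w)"
  shows "real (card T) \<le> (1 + 2 / \<eta>) ^ dim S"
proof -
  have "dim S \<le> card (Basis :: 'a set)"
    by (rule dim_subset_UNIV)
  then obtain J :: "'a set" where J: "J \<subseteq> Basis" "card J = dim S"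
    by (meson obtain_subset_with_card_n)
  have "independent J"
    using J(1) independent_Basis independent_mono by blast
  then have dimJ: "dim (span J) = dim S"
    using J(2) by (simp add: dim_eq_card_independent)
  obtain f :: "'a \<Rightarrow> 'a" where f: "linear f" "f ` span J = S" "\<And>x. x \<in> span J \<Longrightarrow> norm (f x) = norm x"
    using isometry_subspaces[OF subspace_span S dimJ] by blast
  define M where "M = N \<circ> f"
  define P where "P x = (\<Sum>j\<in>J. (x \<bullet> j) *\<^sub>R j)" for x :: 'a
  have P_add: "P (x + y) = P x + P y" for x y
    by (simp add: P_def inner_add_left scaleR_add_left sum.distrib)
  have P_id: "P x = x" and x_off: "\<And>i. i \<in> Basis - J \<Longrightarrow> x \<bullet> i = 0" if "x \<in> span J" for x
  proof -
    have *: "\<forall>i\<in>Basis. i \<notin> J \<longrightarrow> x \<bullet> i = 0"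
      using that J(1) by (simp add: span_substd_basis)
    then show "\<And>i. i \<in> Basis - J \<Longrightarrow> x \<bullet> i = 0"
      by simp
    show "P x = x"
    proof (rule euclidean_eqI)
      fix i :: 'a
      assume i: "i \<in> Basis"
      show "P x \<bullet> i = x \<bullet> i"
        unfolding P_def inner_sum_Basis_subset[OF J(1) i] using * i by simp
    qed
  qed
  have cont: "continuous_on UNIV M"
    unfolding M_def using linear_continuous_on[of f UNIV] f(1) is_norm_continuous_on[OF N]
    by (intro continuous_on_compose) (auto simp: linear_conv_bounded_linear)
  have M_scale: "M (c *\<^sub>R x) = \<bar>c\<bar> * M x" for c x
    by (simp add: M_def linear_scale[OF f(1)] is_norm_scaleR[OF N])
  have M_add: "M (x + y) \<le> M x + M y" and M_diff: "M (x - y) \<le> M x + M y" for x y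
    by (simp_all add: M_def linear_add[OF f(1)] linear_diff[OF f(1)] is_norm_triangle[OF N]
        is_norm_triangle_diff[OF N])
  obtain a where a: "0 < a" "\<And>x. a * norm x \<le> N x"
    using is_norm_ge_norm[OF N] by blast
  define K where "K = cyl_body M J"
  have K_iff: "x \<in> K c \<longleftrightarrow> M (P x) < c \<and> (\<forall>j\<in>Basis - J. \<bar>x \<bullet> j\<bar> < 1)" for x c
    by (simp add: K_def cyl_body_def P_def)
  have openK: "open (K c)" for c
    unfolding K_def by (rule open_cyl_body[OF cont])
  have bddK: "bounded (K c)" for c
    unfolding K_def using a f by (intro bounded_cyl_body[OF J(1), of a]) (auto simp: M_def, metis)
  have lm: "K c \<in> lmeasurable" for c
    by (simp add: openK bddK lmeasurable_open)
  define V where "V = measure lebesgue (K 1)"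
  have measK: "measure lebesgue (K c) = c ^ dim S * V" if "0 < c" for c
  proof -
    have "emeasure lborel (K c) = ennreal (c ^ dim S) * emeasure lborel (K 1)"
      unfolding K_def J(2)[symmetric] using that
      by (intro emeasure_cyl_body J(1) cont) (simp_all add: M_scale)
    then show ?thesis
      using that openK by (simp add: V_def measure_def enn2real_mult)
  qed
  \<comment> \<open>A nonempty open set has positive measure, so \<open>V\<close> can be cancelled
    at the end.\<close>
  have "0 \<in> K 1"
    by (simp add: K_iff P_def M_def linear_0[OF f(1)] is_norm_zero[OF N])
  then have "\<not> negligible (K 1)"
    using openK open_not_negligible by blast
  then have V: "0 < V"
    using lm[of 1] unfolding V_def by (metis measure_nonneg negligible_iff_measure order_le_less)
  obtain g where g: "\<And>z. z \<in> T \<Longrightarrow> g z \<in> span J \<and> f (g z) = z"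
  proof -
    have "\<forall>z\<in>T. \<exists>p. p \<in> span J \<and> f p = z"
      using T(2) f(2) by blast
    then show thesis
      using that by metis
  qed
  define h where "h = \<eta> / 2"
  have h: "0 < h"
    using \<eta> by (simp add: h_def)
  have disj: "disjnt ((+) (g z) ` K h) ((+) (g w) ` K h)" if "z \<in> T" "w \<in> T" "z \<noteq> w" for z w
  proof -
    have False if "k \<in> K h" "l \<in> K h" "g z + k = g w + l" for k l
    proof -
      \<comment> \<open>Projecting with \<open>P\<close> removes the cube coordinates, so an overlap
        is measured by \<open>M\<close> alone, where \<open>P k\<close> and \<open>P l\<close> each
        contribute less than \<open>\<eta> / 2\<close>.\<close>
      have "g z + P k = g w + P l"
        using P_add[of "g z" k] P_add[of "g w" l] that(3) P_id g \<open>z \<in> T\<close> \<open>w \<in> T\<close> by metis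
      then have eq: "g z - g w = P l - P k"
        by (simp add: algebra_simps)
      have "\<eta> \<le> N (z - w)"
        using sep \<open>z \<in> T\<close> \<open>w \<in> T\<close> \<open>z \<noteq> w\<close> by blast
      also have "\<dots> = M (g z - g w)"
        using g \<open>z \<in> T\<close> \<open>w \<in> T\<close> by (simp add: M_def linear_diff[OF f(1)])
      also have "\<dots> \<le> M (P l) + M (P k)"
        unfolding eq by (rule M_diff)
      also have "\<dots> < \<eta>"
        using that(1,2) by (simp add: K_iff h_def)
      finally show False
        by simp
    qed
    then show ?thesis
      by (auto simp: disjnt_def)
  qed
  \<comment> \<open>The centres \<open>g z\<close> lie in \<open>span J\<close>, so translating by
    them leaves the cube coordinates unchanged and only the radius grows.\<close>
  have sub: "(\<Union>z\<in>T. (+) (g z) ` K h) \<subseteq> K (1 + h)"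
  proof clarify
    fix z k assume z: "z \<in> T" and k: "k \<in> K h"
    have "M (P (g z + k)) \<le> M (g z) + M (P k)"
      using g[OF z] by (simp add: P_add P_id M_add)
    also have "\<dots> < 1 + h"
      using g[OF z] T(3)[OF z] k by (simp add: M_def K_iff)
    finally show "g z + k \<in> K (1 + h)"
      using k g[OF z] x_off[of "g z"] by (simp add: K_iff inner_add_left)
  qed
  have "real (card T) * (h ^ dim S * V) = (\<Sum>z\<in>T. measure lebesgue ((+) (g z) ` K h))"
    by (simp add: measure_translation measK[OF h])
  also have "\<dots> = measure lebesgue (\<Union>z\<in>T. (+) (g z) ` K h)"
    using T(1) lm disj
    by (intro measure_UNION'[symmetric]) (auto simp: pairwise_def intro: measurable_translation)
  also have "\<dots> \<le> measure lebesgue (K (1 + h))"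
    using T(1) lm by (intro measure_mono_fmeasurable sub) (auto intro!: sets.finite_UN fmeasurableD measurable_translation)
  also have "\<dots> = (1 + h) ^ dim S * V"
    using h by (intro measK) simp
  finally have "real (card T) * h ^ dim S \<le> (1 + h) ^ dim S"
    using V by simp
  then have "real (card T) \<le> ((1 + h) / h) ^ dim S"
    using h by (simp add: power_divide pos_le_divide_eq)
  also have "(1 + h) / h = 1 + 2 / \<eta>"
    using \<eta> by (simp add: h_def field_simps)
  finally show ?thesis .
qed

text \<open>A separated subset of the sphere of largest cardinality is a net, since a point at
  distance at least \<open>\<eta>\<close> from all of it could be added.
  \<open>packing_bound\<close> shows that the maximum exists and bounds it.\<close>

lemma sphere_net:
  fixes S :: "'a::euclidean_space set"
  assumes N: "is_norm N" and S: "subspace S" and \<eta>: "0 < \<eta>"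
  obtains T where "finite T" "T \<subseteq> {z \<in> S. N z = 1}" "real (card T) \<le> (1 + 2 / \<eta>) ^ dim S"
    "\<And>y. \<lbrakk>y \<in> S; N y = 1\<rbrakk> \<Longrightarrow> \<exists>z\<in>T. N (y - z) < \<eta>"
proof -
  define Q where "Q T \<longleftrightarrow> finite T \<and> T \<subseteq> {z \<in> S. N z = 1} \<and>
    (\<forall>z\<in>T. \<forall>w\<in>T. z \<noteq> w \<longrightarrow> \<eta> \<le> N (z - w))" for T
  have bound: "real (card T) \<le> (1 + 2 / \<eta>) ^ dim S" if "Q T" for T
    using that by (intro packing_bound[OF N S \<eta>]) (auto simp: Q_def)
  have "Q {}"
    by (simp add: Q_def)
  moreover have "\<forall>T. Q T \<longrightarrow> card T < Suc (nat \<lceil>(1 + 2 / \<eta>) ^ dim S\<rceil>)"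
  proof (intro allI impI)
    fix T assume "Q T"
    then show "card T < Suc (nat \<lceil>(1 + 2 / \<eta>) ^ dim S\<rceil>)"
      using bound[of T] by linarith
  qed
  ultimately obtain T where T: "Q T" "\<And>U. Q U \<Longrightarrow> card U \<le> card T"
    using ex_has_greatest_nat[of Q "{}" card] by blast
  show thesis
  proof
    show "finite T" "T \<subseteq> {z \<in> S. N z = 1}"
      using T(1) by (auto simp: Q_def)
    show "real (card T) \<le> (1 + 2 / \<eta>) ^ dim S"
      by (rule bound[OF T(1)])
    fix y assume y: "y \<in> S" "N y = 1"
    show "\<exists>z\<in>T. N (y - z) < \<eta>"
    proof (rule ccontr)
      assume "\<not> ?thesis"
      then have far: "\<eta> \<le> N (y - z)" "\<eta> \<le> N (z - y)" if "z \<in> T" for z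
        using that is_norm_minus[OF N, of "y - z"] by force+
      then have "y \<notin> T"
        using \<eta> is_norm_zero[OF N] by force
      moreover have "Q (insert y T)"
        using T(1) y far by (auto simp: Q_def)
      ultimately show False
        using T(2)[of "insert y T"] T(1) by (simp add: Q_def)
    qed
  qed
qed

section \<open>Sub-Gaussian concentration for random subsets\<close>

text \<open>Compares the coefficients of \<open>x ^ (2 * n)\<close> in the series of
  \<open>cosh x\<close> and \<open>exp (x\<^sup>2 / 2)\<close>.\<close>

lemma fact_two_power_le_fact_double: "fact n * 2 ^ n \<le> (fact (2 * n) :: real)"
proof (induction n)
  case (Suc n)
  have "fact (Suc n) * 2 ^ Suc n = (2 * real (Suc n)) * (fact n * 2 ^ n)"
    by simp
  also have "\<dots> \<le> (2 * real (Suc n)) * fact (2 * n)"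
    by (intro mult_left_mono Suc.IH) simp
  also have "\<dots> \<le> (2 * real (Suc n)) * (real (Suc (2 * n)) * fact (2 * n))"
    by (intro mult_left_mono) (simp_all add: mult_le_cancel_right1)
  also have "\<dots> = fact (2 * Suc n)"
    by (simp add: algebra_simps)
  finally show ?case .
qed simp

lemma cosh_le_exp_half_square: "cosh x \<le> exp (x\<^sup>2 / 2)" for x :: real
proof (rule sums_le)
  let ?f = "\<lambda>n. if even n then x ^ n /\<^sub>R fact n else 0"
  \<comment> \<open>The odd terms are 0, so passing to the even ones keeps the sum and allows a
    termwise comparison.\<close>
  have "(\<lambda>n. ?f (2 * n)) sums cosh x \<longleftrightarrow> ?f sums cosh x"
    by (rule sums_mono_reindex) (auto simp: strict_mono_def)
  then show "(\<lambda>n. ?f (2 * n)) sums cosh x"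
    using cosh_converges[of x] by simp
  show "(\<lambda>n. (x\<^sup>2 / 2) ^ n /\<^sub>R fact n) sums exp (x\<^sup>2 / 2)"
    by (rule exp_converges)
  fix n
  have "x ^ (2 * n) / fact (2 * n) \<le> x ^ (2 * n) / (fact n * 2 ^ n)"
    by (intro divide_left_mono fact_two_power_le_fact_double) simp_all
  then show "?f (2 * n) \<le> (x\<^sup>2 / 2) ^ n /\<^sub>R fact n"
    by (simp add: power_mult power_divide inverse_eq_divide)
qed

text \<open>Moment generating function of a sum with random signs: divided by
  \<open>2 ^ card I\<close>, the left side is an expectation over a uniform subset \<open>X\<close>.
  It factors over the indices into the product of the \<open>cosh (l * a i)\<close>.\<close>

lemma sum_Pow_exp_le:
  fixes a :: "'i \<Rightarrow> real"
  assumes "finite I"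
  shows "(\<Sum>X\<in>Pow I. exp (l * (sum a X - sum a (I - X)))) \<le> 2 ^ card I * exp (l\<^sup>2 * (\<Sum>i\<in>I. (a i)\<^sup>2) / 2)"
proof -
  have "exp (l * (sum a X - sum a (I - X))) = (\<Prod>i\<in>X. exp (l * a i)) * (\<Prod>i\<in>I - X. exp (- (l * a i)))"
    if "X \<in> Pow I" for X
  proof -
    have "finite X"
      using that assms finite_subset by blast
    then show ?thesis
      using assms by (simp add: right_diff_distrib exp_diff exp_minus sum_distrib_left exp_sum
          divide_inverse flip: prod_inversef)
  qed
  then have "(\<Sum>X\<in>Pow I. exp (l * (sum a X - sum a (I - X))))
      = (\<Prod>i\<in>I. exp (l * a i) + exp (- (l * a i)))"
    unfolding prod_add[OF assms] by (rule sum.cong[OF refl])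
  also have "\<dots> \<le> (\<Prod>i\<in>I. 2 * exp ((l * a i)\<^sup>2 / 2))"
  proof (rule prod_mono)
    show "0 \<le> exp (l * a i) + exp (- (l * a i)) \<and>
        exp (l * a i) + exp (- (l * a i)) \<le> 2 * exp ((l * a i)\<^sup>2 / 2)" for i
      using cosh_le_exp_half_square[of "l * a i"] by (simp add: cosh_field_def)
  qed
  also have "\<dots> = 2 ^ card I * exp (\<Sum>i\<in>I. (l * a i)\<^sup>2 / 2)"
    by (simp add: prod.distrib exp_sum assms)
  also have "(\<Sum>i\<in>I. (l * a i)\<^sup>2 / 2) = l\<^sup>2 * (\<Sum>i\<in>I. (a i)\<^sup>2) / 2"
    by (simp add: power_mult_distrib sum_distrib_left sum_divide_distrib)
  finally show ?thesis .
qed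

text \<open>Chernoff bound and union bound over \<open>T\<close>, phrased as counting: if every
  subset failed at some \<open>z\<close>, the exponential weights \<open>E z X\<close> would sum to
  at least \<open>2 ^ card I\<close>, whereas the moment bound and \<open>small\<close> make that
  sum smaller.\<close>

lemma balancing_subset:
  fixes a :: "'z \<Rightarrow> 'i \<Rightarrow> real"
  assumes I: "finite I" and T: "finite T" and s: "0 < s" and v: "0 < v"
    and a: "\<And>z. z \<in> T \<Longrightarrow> (\<Sum>i\<in>I. (a z i)\<^sup>2) \<le> v"
    and small: "2 * real (card T) * exp (- (s\<^sup>2 / (2 * v))) < 1"
  shows "\<exists>X\<subseteq>I. \<forall>z\<in>T. \<bar>sum (a z) X - sum (a z) (I - X)\<bar> < s"
proof (rule ccontr)
  assume major: "\<not> ?thesis"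
  then have contra: "\<exists>z\<in>T. s \<le> \<bar>sum (a z) X - sum (a z) (I - X)\<bar>" if "X \<subseteq> I" for X
    using that major by (metis not_le)
  define D where "D z X = sum (a z) X - sum (a z) (I - X)" for z X
  \<comment> \<open>The minimiser of \<open>l\<^sup>2 * v / 2 - l * s\<close>, the exponent reached
    below.\<close>
  define l where "l = s / v"
  have l: "0 < l"
    using s v by (simp add: l_def)
  \<comment> \<open>Exponential Markov inequality: \<open>E z X\<close> is nonnegative, and at least
    1 whenever \<open>s \<le> \<bar>D z X\<bar>\<close>. The two terms treat the two signs of the
    deviation.\<close>
  define E where "E z X = exp (l * D z X - l * s) + exp (- l * D z X - l * s)" for z X
  have E0: "0 \<le> E z X" for z X
    by (simp add: E_def)
  have "1 \<le> (\<Sum>z\<in>T. E z X)" if X: "X \<in> Pow I" for X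
  proof -
    obtain z where z: "z \<in> T" "s \<le> \<bar>D z X\<bar>"
      using contra[of X] X by (auto simp: D_def)
    then consider "s \<le> D z X" | "s \<le> - D z X"
      by linarith
    then have "1 \<le> E z X"
    proof cases
      case 1
      then have "l * s \<le> l * D z X"
        using l by (intro mult_left_mono) simp_all
      then have "1 \<le> exp (l * D z X - l * s)"
        by simp
      then show ?thesis
        unfolding E_def by (rule add_increasing2[OF exp_ge_zero])
    next
      case 2
      then have "l * s \<le> l * (- D z X)"
        using l by (intro mult_left_mono) simp_all
      then have "1 \<le> exp (- l * D z X - l * s)"
        by simp
      then show ?thesis
        unfolding E_def by (rule add_increasing[OF exp_ge_zero])
    qed
    also have "\<dots> \<le> (\<Sum>z\<in>T. E z X)"
      using z(1) T E0 by (intro member_le_sum) auto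
    finally show ?thesis .
  qed
  then have "(\<Sum>X\<in>Pow I. 1) \<le> (\<Sum>X\<in>Pow I. \<Sum>z\<in>T. E z X)"
    by (intro sum_mono)
  then have "2 ^ card I \<le> (\<Sum>X\<in>Pow I. \<Sum>z\<in>T. E z X)"
    using I by (simp add: card_Pow)
  also have "\<dots> = (\<Sum>z\<in>T. \<Sum>X\<in>Pow I. E z X)"
    by (rule sum.swap)
  also have "\<dots> \<le> (\<Sum>z\<in>T. 2 * 2 ^ card I * exp (- (s\<^sup>2 / (2 * v))))"
  proof (rule sum_mono)
    fix z assume z: "z \<in> T"
    have "(\<Sum>X\<in>Pow I. exp (k * D z X)) \<le> 2 ^ card I * exp (l\<^sup>2 * v / 2)" if "k\<^sup>2 = l\<^sup>2" for k
    proof -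
      have "(\<Sum>X\<in>Pow I. exp (k * D z X)) \<le> 2 ^ card I * exp (k\<^sup>2 * (\<Sum>i\<in>I. (a z i)\<^sup>2) / 2)"
        unfolding D_def by (rule sum_Pow_exp_le[OF I])
      also have "\<dots> \<le> 2 ^ card I * exp (l\<^sup>2 * v / 2)"
        unfolding that
        by (intro mult_left_mono divide_right_mono iffD2[OF exp_le_cancel_iff] a[OF z]) simp_all
      finally show ?thesis .
    qed
    from this[of l] this[of "- l"]
    have le: "(\<Sum>X\<in>Pow I. exp (l * D z X)) + (\<Sum>X\<in>Pow I. exp (- l * D z X)) \<le> 2 * 2 ^ card I * exp (l\<^sup>2 * v / 2)"
      by simp
    have "(\<Sum>X\<in>Pow I. E z X)
        = ((\<Sum>X\<in>Pow I. exp (l * D z X)) + (\<Sum>X\<in>Pow I. exp (- l * D z X))) * exp (- (l * s))"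
      by (simp only: E_def diff_conv_add_uminus exp_add sum.distrib distrib_right flip: sum_distrib_right)
    also have "\<dots> \<le> 2 * 2 ^ card I * exp (l\<^sup>2 * v / 2) * exp (- (l * s))"
      using le by (intro mult_right_mono) simp_all
    also have "\<dots> = 2 * 2 ^ card I * exp (l\<^sup>2 * v / 2 - l * s)"
      by (simp only: diff_conv_add_uminus exp_add mult.assoc)
    also have "l\<^sup>2 * v / 2 - l * s = - (s\<^sup>2 / (2 * v))"
      using v by (simp add: l_def power2_eq_square divide_simps)
    finally show "(\<Sum>X\<in>Pow I. E z X) \<le> 2 * 2 ^ card I * exp (- (s\<^sup>2 / (2 * v)))" .
  qed
  also have "\<dots> = 2 ^ card I * (2 * real (card T) * exp (- (s\<^sup>2 / (2 * v))))"
    by simp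
  also have "\<dots> < 2 ^ card I * 1"
    using small by (intro mult_strict_left_mono) simp_all
  finally show False
    by simp
qed

section \<open>Splitting the coordinates of all vectors of a subspace\<close>

text \<open>\<open>balancing_subset\<close> is applied to the q-th powers of the coordinates of the
  net points. One \<open>\<Omega>\<close> serves all vectors of \<open>S\<close> at once, which is
  why the norm on the domain of the matrix can be arbitrary later.\<close>

lemma coordinate_splitting:
  fixes S :: "(real^'m) set"
  assumes q: "1 \<le> q" and S: "subspace S" and \<epsilon>: "0 < \<epsilon>" and \<eta>: "0 < \<eta>" and s: "0 < s"
    and flat: "\<And>y i. y \<in> S \<Longrightarrow> \<bar>y $ i\<bar> \<le> \<epsilon> * lq_norm q UNIV (\<lambda>i. y $ i)"
    and small: "2 * (1 + 2 / \<eta>) ^ dim S * exp (- (s\<^sup>2 / (2 * \<epsilon> powr q))) < 1"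
  shows "\<exists>\<Omega>. \<forall>y\<in>S. \<forall>X\<in>{\<Omega>, - \<Omega>}. lq_norm q X (\<lambda>i. y $ i)
    \<le> (((1 + s) / 2) powr (1 / q) + \<eta>) * lq_norm q UNIV (\<lambda>i. y $ i)"
proof -
  have q0: "0 < q"
    using q by simp
  define N where "N y = lq_norm q UNIV (\<lambda>i. y $ i)" for y :: "real^'m"
  have N: "is_norm N"
    unfolding N_def[abs_def] by (rule is_norm_lq_norm[OF q])
  obtain T where T: "finite T" "T \<subseteq> {z \<in> S. N z = 1}" "real (card T) \<le> (1 + 2 / \<eta>) ^ dim S"
    and net: "\<And>y. \<lbrakk>y \<in> S; N y = 1\<rbrakk> \<Longrightarrow> \<exists>z\<in>T. N (y - z) < \<eta>"
    using sphere_net[OF N S \<eta>] by blast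
  define a where "a z i = \<bar>z $ i\<bar> powr q" for z :: "real^'m" and i
  have a_sum: "(\<Sum>i\<in>UNIV. a z i) = 1" if "z \<in> T" for z
    using that T(2) lq_norm_powr[OF q0, of UNIV "\<lambda>i. z $ i"] by (auto simp: a_def N_def)
  \<comment> \<open>Flatness bounds each \<open>a z i\<close> by \<open>\<epsilon> powr q\<close>,
    and for fixed \<open>z\<close> they sum to 1; this gives the variance parameter.\<close>
  have a_sq: "(\<Sum>i\<in>UNIV. (a z i)\<^sup>2) \<le> \<epsilon> powr q" if "z \<in> T" for z
  proof -
    have "a z i \<le> \<epsilon> powr q" for i
      using flat[of z i] that T(2) q by (auto simp: a_def N_def intro!: powr_mono2)
    then have "(\<Sum>i\<in>UNIV. (a z i)\<^sup>2) \<le> (\<Sum>i\<in>UNIV. \<epsilon> powr q * a z i)"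
      unfolding power2_eq_square by (intro sum_mono mult_right_mono) (simp_all add: a_def)
    also have "\<dots> = \<epsilon> powr q"
      by (simp add: a_sum[OF that] flip: sum_distrib_left)
    finally show ?thesis .
  qed
  have "2 * real (card T) * exp (- (s\<^sup>2 / (2 * \<epsilon> powr q)))
      \<le> 2 * (1 + 2 / \<eta>) ^ dim S * exp (- (s\<^sup>2 / (2 * \<epsilon> powr q)))"
    using T(3) by (intro mult_right_mono mult_left_mono) simp_all
  also note small
  finally have "\<exists>\<Omega>\<subseteq>UNIV. \<forall>z\<in>T. \<bar>sum (a z) \<Omega> - sum (a z) (UNIV - \<Omega>)\<bar> < s"
    using \<epsilon> s T(1) a_sq by (intro balancing_subset[where v = "\<epsilon> powr q"]) simp_all
  then obtain \<Omega> where \<Omega>: "\<And>z. z \<in> T \<Longrightarrow> \<bar>sum (a z) \<Omega> - sum (a z) (- \<Omega>)\<bar> < s"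
    by (auto simp: Compl_eq_Diff_UNIV)
  \<comment> \<open>The two sums add up to 1 and differ by less than \<open>s\<close>, so each is at
    most \<open>(1 + s) / 2\<close>.\<close>
  have half: "lq_norm q X (\<lambda>i. z $ i) \<le> ((1 + s) / 2) powr (1 / q)" if "z \<in> T" "X \<in> {\<Omega>, - \<Omega>}" for z X
  proof -
    have "sum (a z) \<Omega> + sum (a z) (- \<Omega>) = 1"
      using a_sum[OF that(1)] sum.union_disjoint[of \<Omega> "- \<Omega>" "a z"] by simp
    with \<Omega>[OF that(1)] have "sum (a z) X \<le> (1 + s) / 2"
      using that(2) by auto
    then show ?thesis
      unfolding lq_norm_def using q
      by (intro powr_mono2) (simp_all add: a_def sum_nonneg)
  qed
  have unit: "lq_norm q X (\<lambda>i. y $ i) \<le> ((1 + s) / 2) powr (1 / q) + \<eta>"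
    if y: "y \<in> S" "N y = 1" and X: "X \<in> {\<Omega>, - \<Omega>}" for y X
  proof -
    obtain z where z: "z \<in> T" "N (y - z) < \<eta>"
      using net[OF y] by blast
    \<comment> \<open>Restriction to \<open>X\<close> cannot increase the norm of the error
      \<open>y - z\<close>, so passing from \<open>z\<close> to \<open>y\<close> costs less than
      \<open>\<eta>\<close>.\<close>
    have "lq_norm q X (\<lambda>i. z $ i + (y - z) $ i)
        \<le> lq_norm q X (\<lambda>i. z $ i) + lq_norm q X (\<lambda>i. (y - z) $ i)"
      by (intro lq_norm_triangle q) simp
    also have "lq_norm q X (\<lambda>i. (y - z) $ i) \<le> N (y - z)"
      unfolding N_def by (intro lq_norm_mono q0) simp_all
    finally show ?thesis
      using half[OF z(1) X] z(2) by simp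
  qed
  have "lq_norm q X (\<lambda>i. y $ i) \<le> (((1 + s) / 2) powr (1 / q) + \<eta>) * N y"
    if y: "y \<in> S" and X: "X \<in> {\<Omega>, - \<Omega>}" for y X
  proof (cases "N y = 0")
    case True
    then show ?thesis
      using lq_norm_mono[OF q0, of UNIV X "\<lambda>i. y $ i"] lq_norm_nonneg[of q X "\<lambda>i. y $ i"]
      by (simp add: N_def)
  next
    case False
    then have pos: "0 < N y"
      using is_norm_nonneg[OF N, of y] by simp
    have "inverse (N y) *\<^sub>R y \<in> S"
      by (rule subspace_scale[OF S y])
    moreover have "N (inverse (N y) *\<^sub>R y) = 1"
      using pos by (simp add: is_norm_scaleR[OF N])
    ultimately have "lq_norm q X (\<lambda>i. inverse (N y) * y $ i) \<le> ((1 + s) / 2) powr (1 / q) + \<eta>"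
      using unit[of "inverse (N y) *\<^sub>R y" X] X by simp
    then have "lq_norm q X (\<lambda>i. y $ i) / N y \<le> ((1 + s) / 2) powr (1 / q) + \<eta>"
      unfolding lq_norm_scale[OF q0] using pos by (simp add: inverse_eq_divide)
    then show ?thesis
      using pos by (simp only: pos_divide_le_eq)
  qed
  then show ?thesis
    unfolding N_def by blast
qed

text \<open>Bernoulli's inequality for exponents in [0,1]: weighted AM-GM for \<open>1 + s\<close>
  and \<open>1\<close> with weights \<open>p\<close> and \<open>1 - p\<close>.\<close>

lemma one_add_powr_le:
  fixes s p :: real
  assumes "0 \<le> s" "0 \<le> p" "p \<le> 1"
  shows "(1 + s) powr p \<le> 1 + p * s"
  using Youngs_inequality_0[of p "1 - p" "1 + s" 1] assms by (simp add: algebra_simps)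

section \<open>The (X,q)-norm and the choice of constants\<close>

text \<open>Needed for the supremum in \<open>Xq_norm\<close> to be an upper bound. By
  \<open>is_norm_ge_norm\<close> the unit ball of \<open>nX\<close> is bounded in the Euclidean
  norm, and both \<open>A\<close> and the lq norm are bounded relative to Euclidean norms.\<close>

lemma bdd_above_Xq_norm:
  fixes A :: "real^'n^'m"
  assumes q: "1 \<le> q" and nX: "is_norm nX"
  shows "bdd_above ((\<lambda>x. lq_norm q I (\<lambda>i. (A *v x) $ i)) ` {x. nX x \<le> 1})"
proof -
  define N where "N y = lq_norm q UNIV (\<lambda>i. y $ i)" for y :: "real^'m"
  have N: "is_norm N"
    unfolding N_def[abs_def] by (rule is_norm_lq_norm[OF q])
  obtain C where C: "0 \<le> C" "\<And>y. N y \<le> C * norm y"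
    using is_norm_le_norm[OF N] by blast
  obtain c where c: "0 < c" "\<And>x. c * norm x \<le> nX x"
    using is_norm_ge_norm[OF nX] by blast
  obtain B where B: "0 < B" "\<And>x. norm (A *v x) \<le> norm x * B"
    using bounded_linear.pos_bounded[OF matrix_vector_mul_bounded_linear[of A]] by blast
  show ?thesis
  proof (intro bdd_aboveI2)
    fix x assume "x \<in> {x. nX x \<le> 1}"
    then have "c * norm x \<le> 1"
      using c(2)[of x] by simp
    then have "norm x \<le> 1 / c"
      using c(1) by (simp add: field_simps)
    have "lq_norm q I (\<lambda>i. (A *v x) $ i) \<le> N (A *v x)"
      unfolding N_def using q by (intro lq_norm_mono) simp_all
    also have "\<dots> \<le> C * (norm x * B)"
      using C B(2)[of x] by (meson mult_left_mono order_trans)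
    also have "\<dots> \<le> C * (1 / c * B)"
      using C(1) B(1) \<open>norm x \<le> 1 / c\<close> by (intro mult_left_mono mult_right_mono) simp_all
    finally show "lq_norm q I (\<lambda>i. (A *v x) $ i) \<le> C * (1 / c * B)" .
  qed
qed

lemma lq_norm_le_Xq_norm:
  assumes "1 \<le> q" "is_norm nX" "nX x \<le> 1"
  shows "lq_norm q I (\<lambda>i. (A *v x) $ i) \<le> Xq_norm nX q A I"
  unfolding Xq_norm_def using assms by (intro cSUP_upper bdd_above_Xq_norm) simp_all

lemma Xq_norm_le:
  assumes "is_norm nX" "\<And>x. nX x \<le> 1 \<Longrightarrow> lq_norm q I (\<lambda>i. (A *v x) $ i) \<le> c"
  shows "Xq_norm nX q A I \<le> c"
proof -
  have "nX 0 \<le> 1"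
    by (simp add: is_norm_zero[OF assms(1)])
  then have "{x. nX x \<le> 1} \<noteq> {}"
    by blast
  then show ?thesis
    unfolding Xq_norm_def using assms(2) by (intro cSUP_least) simp_all
qed

lemma Xq_norm_nonneg:
  assumes "1 \<le> q" "is_norm nX"
  shows "0 \<le> Xq_norm nX q A I"
  using lq_norm_le_Xq_norm[OF assms, of 0 I A] lq_norm_nonneg is_norm_zero[OF assms(2)]
  by (metis order_trans zero_le_one)

theorem proposition2:
  fixes q \<epsilon> :: real
    and A :: "real^'n^'m"
    and nX :: "real^'n \<Rightarrow> real"
  assumes "1 \<le> q"
    and "A \<noteq> 0"
    and "0 < \<epsilon>" and "\<epsilon> \<le> real (rank A) powr (- 1 / q)"
    and "is_norm nX"
    and "\<And>x i0. \<bar>row i0 A \<bullet> x\<bar> \<le> \<epsilon> * (\<Sum>i\<in>UNIV. \<bar>row i A \<bullet> x\<bar> powr q) powr (1 / q)"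
  shows "\<exists>\<Omega>1 \<Omega>2. \<Omega>1 \<union> \<Omega>2 = UNIV \<and> \<Omega>1 \<inter> \<Omega>2 = {} \<and>
           Xq_norm nX q A \<Omega>1 \<le> splitting_const q (rank A) \<epsilon> * Xq_norm nX q A UNIV \<and>
           Xq_norm nX q A \<Omega>2 \<le> splitting_const q (rank A) \<epsilon> * Xq_norm nX q A UNIV"
proof -
  note q = assms(1) and nX = assms(5)
  define r where "r = rank A"
  define t where "t = real r * \<epsilon> powr q"
  define L where "L = ln (6 * q / t powr (1 / 3))"
  define w where "w = (t * L) powr (1 / 3)"
  define \<gamma> where "\<gamma> = splitting_const q r \<epsilon>"
  \<comment> \<open>Arranged to match \<open>coordinate_splitting\<close>: the first summand will
    bound \<open>((1 + s) / 2) powr (1 / q)\<close> for \<open>s = 3 * w\<close>, and the second is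
    the net width.\<close>
  have \<gamma>: "\<gamma> = 2 powr (- 1 / q) * (1 + 3 * w / q) + 2 * w / q"
    unfolding \<gamma>_def splitting_const_def t_def[symmetric] L_def[symmetric] w_def[symmetric]
    by (simp add: powr_minus_divide divide_inverse distrib_left distrib_right)
  have "r \<noteq> 0"
    using assms(2) by (simp add: r_def rank_eq_0)
  then have r: "1 \<le> r"
    by simp
  have t0: "0 < t"
    using r assms(3) by (simp add: t_def)
  \<comment> \<open>The upper bound on \<open>\<epsilon>\<close> in terms of \<open>t\<close>. It
    makes the argument of the logarithm at least 6, whence \<open>1 \<le> L\<close> below.\<close>
  have t1: "t \<le> 1"
  proof -
    have "\<epsilon> powr q \<le> (real r powr (- 1 / q)) powr q"
      using assms(3,4) q by (intro powr_mono2) (simp_all add: r_def)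
    also have "\<dots> = 1 / real r"
      using q r powr_minus_divide[of "real r" 1] by (simp add: powr_powr)
    finally show ?thesis
      using r by (simp add: t_def field_simps)
  qed
  have t3: "0 < t powr (1 / 3)" "t powr (1 / 3) \<le> 1"
    using t0 t1 by (simp_all add: powr_le1)
  have expL: "exp L = 6 * q / t powr (1 / 3)"
    using q t3 by (simp add: L_def)
  have L: "1 \<le> L"
  proof -
    have "exp 1 \<le> (6 :: real)"
      using exp_le by simp
    also have "\<dots> \<le> 6 * q / t powr (1 / 3)"
      using q t3 by (simp add: pos_le_divide_eq)
    finally show ?thesis
      unfolding expL[symmetric] by simp
  qed
  \<comment> \<open>This will bound \<open>2 / \<eta> = q / w\<close> by
    \<open>q / t powr (1 / 3)\<close>, tying the size of the net to the argument of the
    logarithm.\<close>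
  have tw: "t powr (1 / 3) \<le> w"
    unfolding w_def using t0 L by (intro powr_mono2) (simp_all add: mult_le_cancel_left1)
  then have w0: "0 < w"
    using t3 by linarith
  have "\<exists>\<Omega>. \<forall>X\<in>{\<Omega>, - \<Omega>}. Xq_norm nX q A X \<le> \<gamma> * Xq_norm nX q A UNIV"
  proof (cases "1 \<le> t * L")
    case True
    then have w1: "1 \<le> w"
      by (simp add: w_def ge_one_powr_ge_zero)
    \<comment> \<open>The goal is \<open>1 \<le> \<gamma>\<close>: the tangent to \<open>exp\<close>
      at 0 and \<open>ln 2 < 1\<close> give \<open>1 - 1 / q \<le> 2 powr (- 1 / q)\<close>, and the
      term \<open>2 * w / q\<close> supplies the missing \<open>1 / q\<close>.\<close>
    have "1 - 1 / q \<le> 1 - ln 2 / q"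
      using q ln_2_less_1 by (simp add: divide_right_mono)
    also have "\<dots> \<le> exp (- ln 2 / q)"
      using exp_ge_add_one_self[of "- ln 2 / q"] by simp
    also have "\<dots> = 2 powr (- 1 / q)"
      by (simp add: powr_def)
    also have "\<dots> \<le> 2 powr (- 1 / q) * (1 + 3 * w / q)"
      using w0 q by (simp add: mult_le_cancel_left1)
    finally have "1 \<le> 2 powr (- 1 / q) * (1 + 3 * w / q) + 1 / q"
      by simp
    also have "\<dots> \<le> \<gamma>"
      unfolding \<gamma> using w1 q by (simp add: divide_right_mono)
    finally have "1 \<le> \<gamma>" .
    moreover have "0 \<le> Xq_norm nX q A UNIV"
      by (rule Xq_norm_nonneg[OF q nX])
    ultimately have "Xq_norm nX q A UNIV \<le> \<gamma> * Xq_norm nX q A UNIV" "0 \<le> \<gamma> * Xq_norm nX q A UNIV"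
      by (simp_all add: mult_le_cancel_right1)
    moreover have "Xq_norm nX q A {} \<le> 0"
      by (rule Xq_norm_le[OF nX]) (simp add: lq_norm_empty)
    ultimately show ?thesis
      by (intro exI[of _ UNIV]) auto
  next
    case False
    define \<eta> s where "\<eta> = 2 * w / q" and "s = 3 * w"
    have \<eta>s: "0 < \<eta>" "0 < s"
      using w0 q by (simp_all add: \<eta>_def s_def)
    have "w\<^sup>2 = (t * L) powr (2 / 3)"
      using t0 L by (simp add: w_def powr_power)
    \<comment> \<open>As \<open>t * L < 1\<close>, lowering the exponent from 1 to 2/3 increases the
      power.\<close>
    moreover have "t * L \<le> (t * L) powr (2 / 3)"
      using powr_mono'[of "2 / 3" 1 "t * L"] False t0 L by simp
    ultimately have w2: "t * L \<le> w\<^sup>2"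
      by simp
    have "real r * L \<le> s\<^sup>2 / (2 * \<epsilon> powr q)"
    proof -
      have "real r * L * (2 * \<epsilon> powr q) = 2 * (t * L)"
        by (simp add: t_def)
      also have "\<dots> \<le> 9 * w\<^sup>2"
        using w2 zero_le_power2[of w] by linarith
      also have "\<dots> = s\<^sup>2"
        by (simp add: s_def power_mult_distrib)
      finally show ?thesis
        using assms(3) by (simp add: pos_le_divide_eq)
    qed
    then have "exp (- (s\<^sup>2 / (2 * \<epsilon> powr q))) \<le> exp (- (real r * L))"
      by simp
    also have "\<dots> = 1 / (6 * q / t powr (1 / 3)) ^ r"
      unfolding expL[symmetric] by (simp add: exp_minus exp_of_nat_mult inverse_eq_divide)
    finally have exp_le: "exp (- (s\<^sup>2 / (2 * \<epsilon> powr q))) \<le> 1 / (6 * q / t powr (1 / 3)) ^ r" .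
    \<comment> \<open>The tail bound at one net point is \<open>1 / (6 * b) ^ r\<close>, to be
      weighed against a net of at most \<open>(2 * b) ^ r\<close> points.\<close>
    define b where "b = q / t powr (1 / 3)"
    have b: "1 \<le> b"
      using q t3 by (simp add: b_def pos_le_divide_eq)
    have "2 / \<eta> = q / w"
      using w0 by (simp add: \<eta>_def)
    also have "\<dots> \<le> b"
      unfolding b_def using q tw t3(1) w0 by (intro divide_left_mono mult_pos_pos) simp_all
    finally have net: "1 + 2 / \<eta> \<le> 2 * b"
      using b by simp
    \<comment> \<open>Since \<open>1 \<le> r\<close>, the factor 2 of the two-sided tail is absorbed
      into \<open>2 ^ r\<close>. The constant 6 in the logarithm then gives the strict inequality
      through \<open>4 * b < 6 * b\<close>.\<close>
    have "2 * (1 + 2 / \<eta>) ^ r \<le> 2 ^ r * (2 * b) ^ r"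
    proof (rule mult_mono)
      show "2 \<le> (2 :: real) ^ r"
        using power_increasing[OF r, of "2::real"] by simp
      show "(1 + 2 / \<eta>) ^ r \<le> (2 * b) ^ r"
        using \<eta>s by (intro power_mono net) simp
    qed (use \<eta>s in simp_all)
    also have "\<dots> = (4 * b) ^ r"
      unfolding power_mult_distrib[symmetric] by simp
    also have "\<dots> < (6 * b) ^ r"
      using b r by (intro power_strict_mono) simp_all
    finally have card: "2 * (1 + 2 / \<eta>) ^ r < (6 * b) ^ r" .
    have "2 * (1 + 2 / \<eta>) ^ r * exp (- (s\<^sup>2 / (2 * \<epsilon> powr q))) \<le> 2 * (1 + 2 / \<eta>) ^ r * (1 / (6 * b) ^ r)"
      using exp_le \<eta>s by (intro mult_left_mono) (simp_all add: b_def)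
    also have "\<dots> < 1"
      using card b by simp
    finally have small: "2 * (1 + 2 / \<eta>) ^ r * exp (- (s\<^sup>2 / (2 * \<epsilon> powr q))) < 1" .
    define S where "S = range (\<lambda>x. A *v x)"
    have S: "subspace S" "dim S = r"
      by (simp_all add: S_def r_def rank_dim_range linear_subspace_image)
    have flat: "\<bar>y $ i\<bar> \<le> \<epsilon> * lq_norm q UNIV (\<lambda>i. y $ i)" if "y \<in> S" for y i
      using that assms(6)[of i] by (auto simp: S_def lq_norm_def matrix_vector_mul_component row_def)
    obtain \<Omega> where \<Omega>: "\<And>y X. \<lbrakk>y \<in> S; X \<in> {\<Omega>, - \<Omega>}\<rbrakk> \<Longrightarrow> lq_norm q X (\<lambda>i. y $ i)
        \<le> (((1 + s) / 2) powr (1 / q) + \<eta>) * lq_norm q UNIV (\<lambda>i. y $ i)"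
      using coordinate_splitting[OF q S(1) assms(3) \<eta>s flat] small S(2) by metis
    have "((1 + s) / 2) powr (1 / q) = 2 powr (- 1 / q) * (1 + s) powr (1 / q)"
      using \<eta>s by (simp add: powr_divide powr_minus_divide)
    also have "\<dots> \<le> 2 powr (- 1 / q) * (1 + 1 / q * s)"
      using q \<eta>s by (intro mult_left_mono one_add_powr_le) simp_all
    finally have le: "((1 + s) / 2) powr (1 / q) + \<eta> \<le> \<gamma>"
      by (simp add: \<gamma> s_def \<eta>_def)
    then have \<gamma>0: "0 \<le> \<gamma>"
      using \<eta>s powr_ge_zero[of "(1 + s) / 2" "1 / q"] by linarith
    have "Xq_norm nX q A X \<le> \<gamma> * Xq_norm nX q A UNIV" if X: "X \<in> {\<Omega>, - \<Omega>}" for X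
    proof (rule Xq_norm_le[OF nX])
      fix x assume x: "nX x \<le> 1"
      have "lq_norm q X (\<lambda>i. (A *v x) $ i)
          \<le> (((1 + s) / 2) powr (1 / q) + \<eta>) * lq_norm q UNIV (\<lambda>i. (A *v x) $ i)"
        using X by (intro \<Omega>) (simp_all add: S_def)
      also have "\<dots> \<le> \<gamma> * lq_norm q UNIV (\<lambda>i. (A *v x) $ i)"
        by (intro mult_right_mono le lq_norm_nonneg)
      also have "\<dots> \<le> \<gamma> * Xq_norm nX q A UNIV"
        by (intro mult_left_mono lq_norm_le_Xq_norm q nX x \<gamma>0)
      finally show "lq_norm q X (\<lambda>i. (A *v x) $ i) \<le> \<gamma> * Xq_norm nX q A UNIV" .
    qed
    then show ?thesis
      by blast
  qed
  then obtain \<Omega> where "\<forall>X\<in>{\<Omega>, - \<Omega>}. Xq_norm nX q A X \<le> \<gamma> * Xq_norm nX q A UNIV" ..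
  then show ?thesis
    unfolding \<gamma>_def r_def by (intro exI[of _ \<Omega>] exI[of _ "- \<Omega>"]) simp
qed

end
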